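(* Let $h>0$, let $K\ge1$ be an integer, and suppose that: (i) the control set $U\subset\mathbb{R}^m$ is nonempty and compact; (ii) the one-step dynamics is affine: $F_h(x,u)=A_hx+B_hu+b_h$ for $x\in\mathbb{R}^n$, $u\in U$, where $A_h\in\mathbb{R}^{n\times n}$, $B_h\in\mathbb{R}^{n\times m}$, $b_h\in\mathbb{R}^n$; (iii) the terminal reward $\phi:\mathbb{R}^n\to\mathbb{R}$ is continuous and $c_K$-semiconvex, for some $c_K\ge0$; (iv) there exists $\gamma_h\ge0$ such that, for every $u\in U$, the map $x\mapsto h\,\ell(x,u)$ is continuous and $\gamma_h$-semiconvex on $\mathbb{R}^n$. Let $v_k^h$, $k=0,\dots,K$, be the discrete-time value functions, defined by $v_K^h=\phi$ and $$v_k^h(x)=\sup_{u\in U}\bigl\{h\,\ell(x,u)+v_{k+1}^h(F_h(x,u))\bigr\},\qquad k=K-1,\dots,0,$$ and assumed to be finite-valued. Define recursively $$c_k:=\gamma_h+\|A_h\|^2c_{k+1},\qquad k=K-1,\dots,0.$$ Then $v_k^h$ is $c_k$-semiconvex for every $k=0,\dots,K$.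
   Context: Here $\ell:\mathbb{R}^n\times U\to\mathbb{R}$ is the running reward of a deterministic optimal control problem. For $c\ge0$, a function $g:\mathbb{R}^n\to\mathbb{R}$ is $c$-semiconvex if $x\mapsto g(x)+\frac c2\|x\|^2$ is convex on $\mathbb{R}^n$, where $\|\cdot\|$ is the Euclidean norm. $\|A_h\|$ is the operator norm of $A_h$ induced by the Euclidean norm. *)

theory Defs
  imports "HOL-Analysis.Analysis"
begin

definition semiconvex :: "real \<Rightarrow> ('a::real_normed_vector \<Rightarrow> real) \<Rightarrow> bool" where
  "semiconvex c g \<longleftrightarrow> 0 \<le> c \<and> convex_on UNIV (\<lambda>x. g x + c / 2 * (norm x)\<^sup>2)"

(* The supremum is taken in the extended reals, so that finiteness of the value functions
   is a genuine hypothesis: on the type real, the supremum of a set that is not bounded above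
   is an unspecified real number. Only the stages k \<le> K are meaningful. *)
function value_fn ::
  "real \<Rightarrow> ('x \<Rightarrow> 'u \<Rightarrow> 'x) \<Rightarrow> ('x \<Rightarrow> 'u \<Rightarrow> real) \<Rightarrow> 'u set \<Rightarrow> ('x \<Rightarrow> real) \<Rightarrow> nat \<Rightarrow> nat \<Rightarrow> 'x \<Rightarrow> ereal"
where
  "value_fn h F l U \<phi> K k x =
     (if k < K then (SUP u\<in>U. ereal (h * l x u) + value_fn h F l U \<phi> K (Suc k) (F x u))
      else ereal (\<phi> x))"
  by pat_completeness auto

termination
  by (relation "Wellfounded.measure (\<lambda>(h, F, l, U, \<phi>, K, k, x). K - k)") auto

declare value_fn.simps [simp del]

end

(* Semiconvexity is equivalent to the Jensen-type inequality with the defect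
   c/2 * t * (1 - t) * |x - y|^2. In this form it clearly passes to pointwise suprema and, since an
   affine map stretches distances by at most the norm of its linear part, to affine
   precompositions; the semiconvexity constants of sums add up. The Bellman recursion is built from
   these three operations. *)
theory Submission
  imports Defs
begin

text \<open>Expanding inner products gives this. It measures exactly how far the squared norm is
  from being affine along a segment, and is the source of the defect term below.\<close>

lemma norm_convex_combination_squared:
  fixes x y :: "'a::real_inner"
  shows "(norm (t *\<^sub>R x + (1 - t) *\<^sub>R y))\<^sup>2
    = t * (norm x)\<^sup>2 + (1 - t) * (norm y)\<^sup>2 - t * (1 - t) * (norm (x - y))\<^sup>2"
  unfolding power2_norm_eq_inner
  by (simp add: inner_add_left inner_add_right inner_diff_left inner_diff_right inner_commute
      algebra_simps)

text \<open>By the preceding identity, the squared norms of \<open>x\<close> and \<open>y\<close>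
  cancel from the convexity inequality for \<open>g x + c / 2 * (norm x)\<^sup>2\<close>; only the
  term in \<open>norm (x - y)\<close> survives.\<close>

lemma semiconvex_iff:
  fixes g :: "'a::real_inner \<Rightarrow> real"
  shows "semiconvex c g \<longleftrightarrow> 0 \<le> c \<and> (\<forall>x y t. 0 \<le> t \<longrightarrow> t \<le> 1 \<longrightarrow>
    g (t *\<^sub>R x + (1 - t) *\<^sub>R y)
      \<le> t * g x + (1 - t) * g y + c / 2 * (t * (1 - t)) * (norm (x - y))\<^sup>2)"
proof -
  have "p + c / 2 * (t * X + (1 - t) * Y - t * (1 - t) * D)
        \<le> t * (a + c / 2 * X) + (1 - t) * (b + c / 2 * Y)
    \<longleftrightarrow> p \<le> t * a + (1 - t) * b + c / 2 * (t * (1 - t)) * D" for p X Y D a b t :: real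
    by (auto simp: field_simps)
  then show ?thesis
    unfolding semiconvex_def convex_on_alt norm_convex_combination_squared by auto
qed

lemma semiconvexD:
  fixes g :: "'a::real_inner \<Rightarrow> real"
  assumes "semiconvex c g" "0 \<le> t" "t \<le> 1"
  shows "g (t *\<^sub>R x + (1 - t) *\<^sub>R y)
    \<le> t * g x + (1 - t) * g y + c / 2 * (t * (1 - t)) * (norm (x - y))\<^sup>2"
  using assms by (simp add: semiconvex_iff)

lemma semiconvex_add:
  assumes "semiconvex a f" "semiconvex b g"
  shows "semiconvex (a + b) (\<lambda>x. f x + g x)"
proof -
  have "convex_on UNIV (\<lambda>x. (f x + a / 2 * (norm x)\<^sup>2) + (g x + b / 2 * (norm x)\<^sup>2))"
    by (rule convex_on_add) (use assms in \<open>simp_all add: semiconvex_def\<close>)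
  then show ?thesis
    using assms by (simp add: semiconvex_def algebra_simps add_divide_distrib)
qed

lemma semiconvex_affine:
  fixes g :: "'b::real_inner \<Rightarrow> real" and T :: "'a::real_inner \<Rightarrow> 'b"
  assumes g: "semiconvex c g" and T: "bounded_linear T"
  shows "semiconvex ((onorm T)\<^sup>2 * c) (\<lambda>x. g (T x + v))"
  unfolding semiconvex_iff
proof (intro conjI allI impI)
  have c: "0 \<le> c"
    using g by (simp add: semiconvex_def)
  then show "0 \<le> (onorm T)\<^sup>2 * c"
    by simp
  fix x y :: 'a and t :: real
  assume t: "0 \<le> t" "t \<le> 1"
  interpret T: bounded_linear T
    by (rule T)
  have "norm (T x - T y) \<le> onorm T * norm (x - y)"
    using onorm[OF T, of "x - y"] by (simp add: T.diff)
  then have lip: "(norm (T x - T y))\<^sup>2 \<le> (onorm T)\<^sup>2 * (norm (x - y))\<^sup>2"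
    by (metis norm_ge_zero power_mono power_mult_distrib)
  \<comment> \<open>The weights sum to one, so the translation \<open>v\<close> splits as
    \<open>t\<close> times \<open>v\<close> plus \<open>1 - t\<close> times
    \<open>v\<close>.\<close>
  have "T (t *\<^sub>R x + (1 - t) *\<^sub>R y) + v = t *\<^sub>R (T x + v) + (1 - t) *\<^sub>R (T y + v)"
    by (simp add: T.add T.scaleR scaleR_add_right flip: scaleR_left.add)
  then have "g (T (t *\<^sub>R x + (1 - t) *\<^sub>R y) + v)
      \<le> t * g (T x + v) + (1 - t) * g (T y + v) + c / 2 * (t * (1 - t)) * (norm (T x - T y))\<^sup>2"
    using semiconvexD[OF g t, of "T x + v" "T y + v"] by simp
  also have "\<dots> \<le> t * g (T x + v) + (1 - t) * g (T y + v)
      + c / 2 * (t * (1 - t)) * ((onorm T)\<^sup>2 * (norm (x - y))\<^sup>2)"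
    using t c by (intro add_left_mono mult_left_mono lip) simp_all
  finally show "g (T (t *\<^sub>R x + (1 - t) *\<^sub>R y) + v)
      \<le> t * g (T x + v) + (1 - t) * g (T y + v)
        + (onorm T)\<^sup>2 * c / 2 * (t * (1 - t)) * (norm (x - y))\<^sup>2"
    by (simp add: mult_ac)
qed

text \<open>At a convex combination, each \<open>f u\<close> is bounded by an expression in
  \<open>g x\<close> and \<open>g y\<close> that no longer depends on \<open>u\<close>, hence so is
  the least upper bound. Describing \<open>g\<close> by \<open>ub\<close> and \<open>lub\<close>
  lets it come from a supremum taken in \<open>ereal\<close>.\<close>

lemma semiconvex_pointwise_lub:
  fixes g :: "'a::real_inner \<Rightarrow> real"
  assumes "0 \<le> c"
    and f: "\<And>u. u \<in> U \<Longrightarrow> semiconvex c (f u)"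
    and ub: "\<And>u x. u \<in> U \<Longrightarrow> f u x \<le> g x"
    and lub: "\<And>x z. (\<And>u. u \<in> U \<Longrightarrow> f u x \<le> z) \<Longrightarrow> g x \<le> z"
  shows "semiconvex c g"
  unfolding semiconvex_iff
proof (intro conjI allI impI)
  show "0 \<le> c"
    by fact
  fix x y :: 'a and t :: real
  assume t: "0 \<le> t" "t \<le> 1"
  show "g (t *\<^sub>R x + (1 - t) *\<^sub>R y)
      \<le> t * g x + (1 - t) * g y + c / 2 * (t * (1 - t)) * (norm (x - y))\<^sup>2"
  proof (rule lub)
    fix u assume u: "u \<in> U"
    have "t * f u x \<le> t * g x" "(1 - t) * f u y \<le> (1 - t) * g y"
      using t ub[OF u] by (auto intro: mult_left_mono)
    then show "f u (t *\<^sub>R x + (1 - t) *\<^sub>R y)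
        \<le> t * g x + (1 - t) * g y + c / 2 * (t * (1 - t)) * (norm (x - y))\<^sup>2"
      using semiconvexD[OF f[OF u] t, of x y] by linarith
  qed
qed

theorem mainTheorem2:
  fixes h :: real and K :: nat
    and U :: "(real ^ 'm) set"
    and F :: "real ^ 'n \<Rightarrow> real ^ 'm \<Rightarrow> real ^ 'n"
    and A :: "real ^ 'n ^ 'n" and B :: "real ^ 'm ^ 'n" and b :: "real ^ 'n"
    and \<phi> :: "real ^ 'n \<Rightarrow> real"
    and l :: "real ^ 'n \<Rightarrow> real ^ 'm \<Rightarrow> real"
    and \<gamma> :: real and c :: "nat \<Rightarrow> real"
  assumes "0 < h" and "1 \<le> K"
    and "U \<noteq> {}" and "compact U"
    and "\<And>x u. u \<in> U \<Longrightarrow> F x u = A *v x + B *v u + b"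
    and "continuous_on UNIV \<phi>" and "0 \<le> c K" and "semiconvex (c K) \<phi>"
    and "0 \<le> \<gamma>"
    and "\<And>u. u \<in> U \<Longrightarrow> continuous_on UNIV (\<lambda>x. h * l x u)"
    and "\<And>u. u \<in> U \<Longrightarrow> semiconvex \<gamma> (\<lambda>x. h * l x u)"
    and "\<And>k x. k \<le> K \<Longrightarrow> \<bar>value_fn h F l U \<phi> K k x\<bar> \<noteq> \<infinity>"
    and "\<And>k. k < K \<Longrightarrow> c k = \<gamma> + (onorm (\<lambda>x. A *v x))\<^sup>2 * c (Suc k)"
  shows "\<forall>k\<le>K. semiconvex (c k) (\<lambda>x. real_of_ereal (value_fn h F l U \<phi> K k x))"
proof (intro allI impI)
  let ?v = "\<lambda>k x. real_of_ereal (value_fn h F l U \<phi> K k x)"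
  \<comment> \<open>Finiteness makes the passage to reals lossless, so the extended-real recursion
    can be read in real terms.\<close>
  have v: "ereal (?v k x) = value_fn h F l U \<phi> K k x" if "k \<le> K" for k x
    using assms(12)[OF that] by (simp add: ereal_real)
  fix k assume "k \<le> K"
  then show "semiconvex (c k) (?v k)"
  proof (induction k rule: inc_induct)
    case base
    then show ?case
      using assms(8) by (simp add: value_fn.simps)
  next
    case (step k)
    \<comment> \<open>The argument of \<open>?v (Suc k)\<close> is grouped as a linear map plus a
      vector constant in \<open>x\<close>, the shape \<open>semiconvex_affine\<close> expects. It
      equals \<open>F x u\<close> for \<open>u\<close> in \<open>U\<close>.\<close>
    define f where "f u x = h * l x u + ?v (Suc k) (A *v x + (B *v u + b))" for u x
    have T: "bounded_linear (\<lambda>x. A *v x)"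
      by (rule matrix_vector_mul_bounded_linear)
    have f: "semiconvex (c k) (f u)" if "u \<in> U" for u
      \<comment> \<open>The recursion turns \<open>c k\<close> into the sum of the constants of the
        running reward and of the affine precomposition.\<close>
      unfolding f_def assms(13)[OF \<open>k < K\<close>]
      by (intro semiconvex_add assms(11) that semiconvex_affine[OF step.IH T])
    have sup: "ereal (?v k x) = (SUP u\<in>U. ereal (f u x))" for x
    proof -
      have "ereal (?v k x)
          = (SUP u\<in>U. ereal (h * l x u) + value_fn h F l U \<phi> K (Suc k) (F x u))"
        using step.hyps v[of k x] by (simp add: value_fn.simps[of h F l U \<phi> K k])
      also have "\<dots> = (SUP u\<in>U. ereal (f u x))"
      proof (rule SUP_cong)
        fix u assume "u \<in> U"
        \<comment> \<open>Since \<open>k < K\<close>, stage \<open>Suc k\<close> is still at most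
          \<open>K\<close>, so \<open>v\<close> applies to the next value function.\<close>
        then show "ereal (h * l x u) + value_fn h F l U \<phi> K (Suc k) (F x u) = ereal (f u x)"
          using step.hyps
          by (simp only: Suc_leI f_def add.assoc assms(5) v flip: plus_ereal.simps(1))
      qed simp
      finally show ?thesis .
    qed
    show ?case
    proof (rule semiconvex_pointwise_lub)
      \<comment> \<open>Some control exists because \<open>U\<close> is nonempty, and semiconvexity
        of its \<open>f u\<close> includes the sign of the constant.\<close>
      show "0 \<le> c k"
        using f assms(3) by (auto simp: semiconvex_def)
      show "f u x \<le> ?v k x" if "u \<in> U" for u x
        using SUP_upper[OF that, of "\<lambda>u. ereal (f u x)"] by (simp flip: sup)
      show "?v k x \<le> z" if "\<And>u. u \<in> U \<Longrightarrow> f u x \<le> z" for x z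
        using SUP_least[of U "\<lambda>u. ereal (f u x)" "ereal z"] that by (simp flip: sup)
    qed (rule f)
  qed
qed

end
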